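(* Let $n\geq 3$ be an integer and let $x_1,\dots,x_n$ be real numbers with $x_1\leq x_2\leq\dots\leq x_n$ and $x_1<x_n$. Let $\bar{x}$, $s$ and $\mathrm{med}\,x$ denote their mean, standard deviation (with normalization $1/n$) and median. Then, with $k\in\mathbb{N}$ determined by $n=2k+1$ (if $n$ is odd) or $n=2k$ (if $n$ is even), $$\frac{|\mathrm{med}\,x-\bar{x}|}{s}\leq \begin{cases}\left(\dfrac{k}{k+1}\right)^{1/2} & \text{if } n=2k+1,\\[2mm] \left(\dfrac{k-1}{k+1}\right)^{1/2} & \text{if } n=2k.\end{cases}$$ Further, for $n=2k$, the equalities $$\frac{\mathrm{med}\,x-\bar{x}}{s}=-\left(\frac{k-1}{k+1}\right)^{1/2},\qquad \frac{\mathrm{med}\,x-\bar{x}}{s}=\left(\frac{k-1}{k+1}\right)^{1/2}$$ are attained by the cases $$x_1=\dots=x_k=x_{k+1}<x_{k+2}=\dots=x_{2k},$$ $$x_1=\dots=x_{k-1}<x_k=x_{k+1}=\dots=x_{2k},$$ respectively; that is, the first equality holds whenever the data have the first form, and the second equality holds whenever the data have the second form.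
   Context: For real data $x_1\leq x_2\leq\dots\leq x_n$ with $x_1<x_n$, the mean is $\bar{x}=\frac{1}{n}\sum_{i=1}^n x_i$, the standard deviation is $s=\sqrt{\frac{1}{n}\sum_{i=1}^n (x_i-\bar{x})^2}$ (which is positive since $x_1<x_n$), and the median is $\mathrm{med}\,x=x_{k+1}$ if $n=2k+1$ and $\mathrm{med}\,x=(x_k+x_{k+1})/2$ if $n=2k$, where $k\in\mathbb{N}=\{1,2,\dots\}$. *)

theory Defs
  imports Complex_Main
begin

text \<open>A data set of size \<open>n\<close> is a function on the index set \<open>{1..n}\<close>; values outside it are irrelevant.\<close>

definition mean :: "nat \<Rightarrow> (nat \<Rightarrow> real) \<Rightarrow> real" where
  "mean n x = (\<Sum>i=1..n. x i) / real n"

definition std_dev :: "nat \<Rightarrow> (nat \<Rightarrow> real) \<Rightarrow> real" where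
  "std_dev n x = sqrt ((\<Sum>i=1..n. (x i - mean n x)\<^sup>2) / real n)"

text \<open>This is the median only of data already arranged in nondecreasing order.\<close>

definition sorted_median :: "nat \<Rightarrow> (nat \<Rightarrow> real) \<Rightarrow> real" where
  "sorted_median n x =
     (if odd n then x (n div 2 + 1) else (x (n div 2) + x (n div 2 + 1)) / 2)"

end

theory Submission
  imports Defs "HOL-Analysis.Convex"
begin

text \<open>
  The distance between the median and the mean is controlled by block averages. Put
  \<open>p = n div 2 + 1\<close>. The average of the \<open>p\<close> smallest data is at most the median and the
  average of the \<open>p\<close> largest data is at least the median; for even \<open>n\<close> both blocks contain the
  two middle entries, whose average is the median, and this is why \<open>p\<close> can be taken as large
  as \<open>k + 1\<close> (\<open>sum_lower_le_median\<close>, \<open>sum_upper_ge_median\<close>). So the median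
  deviates from the mean by no more than one of these two block averages does.

  The average of any \<open>p\<close> out of \<open>n\<close> numbers differs from the overall mean by at most
  \<open>sqrt ((n - p) / p)\<close> standard deviations: the deviations from the mean over the block and over
  its complement have opposite sums, and Cauchy--Schwarz on each of the two blocks bounds the
  variance from below (\<open>block_average_deviation\<close>). With \<open>p = k + 1\<close> the
  complement has \<open>k\<close> elements for \<open>n = 2k + 1\<close> and \<open>k - 1\<close> elements for \<open>n = 2k\<close>, which gives the
  two constants.

  Cauchy--Schwarz is an equality when the data are constant on the block and on its complement;
  then everything can be computed exactly (\<open>two_valued_standard_score\<close>). In the two
  extremal configurations the median is the common value on a block of \<open>k + 1\<close> entries, the lower
  block in the first and the upper block in the second.
\<close>

section \<open>Block averages and the mean\<close>

lemma sum_eq_mean: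
  assumes "n > 0"
  shows "(\<Sum>i=1..n. x i) = real n * mean n x"
  using assms by (simp add: mean_def)

lemma sum_deviations_eq_std_dev:
  assumes "n > 0"
  shows "(\<Sum>i=1..n. (x i - mean n x)\<^sup>2) = real n * (std_dev n x)\<^sup>2"
proof -
  have "0 \<le> (\<Sum>i=1..n. (x i - mean n x)\<^sup>2) / real n"
    by (intro divide_nonneg_nonneg sum_nonneg) auto
  then show ?thesis
    using assms by (simp add: std_dev_def)
qed

lemma std_dev_nonneg: "std_dev n x \<ge> 0"
  unfolding std_dev_def by (intro real_sqrt_ge_zero divide_nonneg_nonneg sum_nonneg) auto

text \<open>
  The deviations sum to \<open>T\<close> over the block and to \<open>- T\<close> over its complement, so
  Cauchy--Schwarz gives the sum of squares at least \<open>T\<^sup>2 / p + T\<^sup>2 / (n - p)\<close>. The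
  case \<open>p = n\<close> is included: then \<open>T = 0\<close>.
\<close>

lemma block_average_deviation:
  assumes A: "A \<subseteq> {1..n}" and p: "card A = p" "p > 0"
  shows "\<bar>(\<Sum>i\<in>A. x i) / real p - mean n x\<bar> \<le> std_dev n x * sqrt ((real n - real p) / real p)"
proof -
  define B where "B = {1..n} - A"
  define y where "y i = x i - mean n x" for i
  define T where "T = (\<Sum>i\<in>A. y i)"
  define q where "q = real n - real p"
  have finA: "finite A" using A finite_subset by blast
  have "p \<le> n" using card_mono[OF _ A] p by simp
  then have n: "n > 0" and q0: "q \<ge> 0" using p by (auto simp: q_def)
  have cB: "real (card B) = q"
    using A finA p \<open>p \<le> n\<close> by (simp add: B_def q_def card_Diff_subset of_nat_diff)
  have split: "(\<Sum>i=1..n. f i) = (\<Sum>i\<in>A. f i) + (\<Sum>i\<in>B. f i)" for f :: "nat \<Rightarrow> real"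
    using sum.subset_diff[OF A, of f] by (simp add: B_def)
  have "(\<Sum>i=1..n. y i) = 0"
    using sum_eq_mean[OF n, of x] by (simp add: y_def sum_subtractf)
  then have TB: "(\<Sum>i\<in>B. y i) = - T"
    using split[of y] by (simp add: T_def)
  have CA: "T\<^sup>2 \<le> (\<Sum>i\<in>A. (y i)\<^sup>2) * real p"
    using sum_squared_le_sum_of_squares[of y A] p by (simp add: T_def)
  have CB: "T\<^sup>2 \<le> (\<Sum>i\<in>B. (y i)\<^sup>2) * q"
    using sum_squared_le_sum_of_squares[of y B] by (simp add: TB cB)
  have "real n * T\<^sup>2 = q * T\<^sup>2 + real p * T\<^sup>2"
    by (simp add: q_def algebra_simps)
  also have "\<dots> \<le> q * ((\<Sum>i\<in>A. (y i)\<^sup>2) * real p) + real p * ((\<Sum>i\<in>B. (y i)\<^sup>2) * q)"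
    using CA CB q0 by (intro add_mono mult_left_mono) auto
  also have "\<dots> = real p * q * (\<Sum>i=1..n. (y i)\<^sup>2)"
    unfolding split by (simp add: algebra_simps)
  also have "\<dots> = real n * (real p * q * (std_dev n x)\<^sup>2)"
    using sum_deviations_eq_std_dev[OF n, of x] by (simp add: y_def)
  finally have T2: "T\<^sup>2 \<le> real p * q * (std_dev n x)\<^sup>2"
    using n by simp
  have avg: "(\<Sum>i\<in>A. x i) / real p - mean n x = T / real p"
    using p by (simp add: T_def y_def sum_subtractf field_simps)
  have "(T / real p)\<^sup>2 \<le> (real p * q * (std_dev n x)\<^sup>2) / (real p)\<^sup>2"
    using T2 by (simp add: power_divide divide_right_mono)
  also have "\<dots> = (std_dev n x)\<^sup>2 * (q / real p)"
    using p by (simp add: field_simps power2_eq_square)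
  also have "\<dots> = (std_dev n x * sqrt (q / real p))\<^sup>2"
    using q0 by (simp add: power_mult_distrib)
  finally have "\<bar>T / real p\<bar> \<le> std_dev n x * sqrt (q / real p)"
    using std_dev_nonneg[of n x] q0 by (simp add: power2_le_iff_abs_le)
  then show ?thesis
    unfolding avg q_def .
qed

text \<open>
  On two-valued data both applications of Cauchy--Schwarz in the preceding proof are equalities, so
  the bound becomes an identity, with the sign telling which of the two values is the larger.
\<close>

lemma two_valued_standard_score:
  assumes A: "A \<subseteq> {1..n}" and p: "card A = p" "0 < p" "p < n"
    and a: "\<And>i. i \<in> A \<Longrightarrow> x i = a" and b: "\<And>i. i \<in> {1..n} - A \<Longrightarrow> x i = b"
    and ab: "a \<noteq> b"
  shows "(a - mean n x) / std_dev n x = sgn (a - b) * sqrt ((real n - real p) / real p)"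
proof -
  define q where "q = real n - real p"
  have finA: "finite A" using A finite_subset by blast
  have pos: "real p > 0" "q > 0" "real n > 0" using p by (auto simp: q_def)
  have nq: "real n = real p + q" by (simp add: q_def)
  have cB: "real (card ({1..n} - A)) = q"
    using A finA p by (simp add: q_def card_Diff_subset of_nat_diff)
  have sums: "(\<Sum>i=1..n. f (x i)) = real p * f a + q * f b" for f :: "real \<Rightarrow> real"
  proof -
    have "(\<Sum>i=1..n. f (x i)) = (\<Sum>i\<in>{1..n} - A. f (x i)) + (\<Sum>i\<in>A. f (x i))"
      using sum.subset_diff[OF A, of "\<lambda>i. f (x i)"] by simp
    also have "\<dots> = (\<Sum>i\<in>{1..n} - A. f b) + (\<Sum>i\<in>A. f a)"
      using a b by (intro arg_cong2[where f = "(+)"] sum.cong) auto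
    finally show ?thesis using p cB by simp
  qed
  have mean: "mean n x = (real p * a + q * b) / real n"
    using sums[of "\<lambda>t. t"] by (simp add: mean_def)
  have da: "a - mean n x = q * (a - b) / real n"
    using pos by (simp add: mean nq field_simps)
  have db: "b - mean n x = - (real p * (a - b) / real n)"
    using pos by (simp add: mean nq field_simps)
  have var: "(p' * (q * d / m)\<^sup>2 + q * (p' * d / m)\<^sup>2) / m = p' * q * d\<^sup>2 * (p' + q) / m^3"
    for p' d m :: real
    by (simp add: power2_eq_square power3_eq_cube divide_inverse algebra_simps)
  have "(\<Sum>i=1..n. (x i - mean n x)\<^sup>2) / real n
      = (real p * (q * (a - b) / real n)\<^sup>2 + q * (real p * (a - b) / real n)\<^sup>2) / real n"
    by (simp only: sums[of "\<lambda>t. (t - mean n x)\<^sup>2"] da db power2_minus)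
  also have "\<dots> = real p * q * (a - b)\<^sup>2 * (real p + q) / (real n)^3"
    by (rule var)
  also have "\<dots> = real p * q * (a - b)\<^sup>2 / (real n)\<^sup>2"
    using pos by (simp add: nq[symmetric] power2_eq_square power3_eq_cube)
  finally have sd: "std_dev n x = sqrt (real p) * sqrt q * \<bar>a - b\<bar> / real n"
    by (simp add: std_dev_def real_sqrt_mult real_sqrt_divide)
  have "(a - mean n x) / std_dev n x
      = (q / sqrt q) * ((a - b) / \<bar>a - b\<bar>) / sqrt (real p)"
    using pos by (simp add: da sd)
  also have "\<dots> = sqrt q * sgn (a - b) / sqrt (real p)"
    using pos ab by (simp add: real_div_sqrt real_sgn_eq)
  finally show ?thesis
    by (simp add: q_def real_sqrt_divide)
qed

section \<open>Block averages and the median\<close>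

text \<open>
  For even \<open>n\<close> the entry of index \<open>n div 2 + 1\<close> may exceed the median. It is compensated by the entry
  just below it, as these two add up to twice the median.
\<close>

lemma sum_lower_le_median:
  assumes "n \<ge> 1" and mono: "mono_on {1..n} x"
  shows "(\<Sum>i=1..n div 2 + 1. x i) \<le> real (n div 2 + 1) * sorted_median n x"
    (is "?L \<le> _")
proof (cases "odd n")
  case True
  have "x i \<le> x (n div 2 + 1)" if "i \<in> {1..n div 2 + 1}" for i
    using that True assms(1) by (intro mono_onD[OF mono]) auto
  then have "?L \<le> real (card {1..n div 2 + 1}) * x (n div 2 + 1)"
    by (rule sum_bounded_above)
  with True show ?thesis by (simp add: sorted_median_def)
next
  case False
  then obtain j where j: "n = 2 * Suc j"
    using assms(1) by (metis evenE mult_0_right not0_implies_Suc not_one_le_zero)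
  have med: "sorted_median n x = (x (Suc j) + x (Suc (Suc j))) / 2"
    using j by (simp add: sorted_median_def)
  have mid: "x (Suc j) \<le> x (Suc (Suc j))"
    using j by (intro mono_onD[OF mono]) auto
  have "x i \<le> x (Suc j)" if "i \<in> {1..j}" for i
    using that j by (intro mono_onD[OF mono]) auto
  then have "x i \<le> sorted_median n x" if "i \<in> {1..j}" for i
    using that mid med by fastforce
  then have "(\<Sum>i=1..j. x i) \<le> real (card {1..j}) * sorted_median n x"
    by (rule sum_bounded_above)
  moreover have "?L = (\<Sum>i=1..j. x i) + 2 * sorted_median n x"
    using j med by simp
  ultimately show ?thesis using j by (simp add: algebra_simps)
qed

text \<open>
  The map \<open>i \<mapsto> - x (n + 1 - i)\<close> keeps the data sorted, exchanges lower and upper blocks and negates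
  the median, so this is the preceding lemma for the reflected data.
\<close>

lemma sum_upper_ge_median:
  assumes n: "n \<ge> 2" and mono: "mono_on {1..n} x"
  shows "(\<Sum>i=n - n div 2..n. x i) \<ge> real (n div 2 + 1) * sorted_median n x"
proof -
  define y where "y i = - x (n + 1 - i)" for i
  have "mono_on {1..n} y"
    unfolding y_def by (intro mono_onI) (auto intro!: mono_onD[OF mono])
  then have "(\<Sum>i=1..n div 2 + 1. y i) \<le> real (n div 2 + 1) * sorted_median n y"
    using n by (intro sum_lower_le_median) auto
  moreover have "(\<Sum>i=1..n div 2 + 1. y i) = - (\<Sum>i=n - n div 2..n. x i)"
    unfolding y_def sum_negf
    using n
    by (intro arg_cong[where f = uminus]
        sum.reindex_bij_witness[of _ "\<lambda>i. n + 1 - i" "\<lambda>i. n + 1 - i"]) auto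
  moreover have "sorted_median n y = - sorted_median n x"
  proof (cases "odd n")
    case True
    then have "n + 1 - (n div 2 + 1) = n div 2 + 1" by presburger
    then show ?thesis using True by (simp add: sorted_median_def y_def)
  next
    case False
    then have "n + 1 - n div 2 = n div 2 + 1" "n + 1 - (n div 2 + 1) = n div 2" by presburger+
    then show ?thesis using False by (simp add: sorted_median_def y_def field_simps)
  qed
  ultimately show ?thesis by simp
qed

text \<open>
  The block size \<open>n div 2 + 1\<close> is the largest for which both comparisons with the median hold
  for all sorted data, hence gives the smallest bound that block averages can give.
\<close>

lemma median_mean_bound:
  assumes n: "n \<ge> 2" and mono: "mono_on {1..n} x"
  defines "p \<equiv> n div 2 + 1"
  shows "\<bar>sorted_median n x - mean n x\<bar> / std_dev n x \<le> sqrt ((real n - real p) / real p)"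
proof -
  define L where "L = (\<Sum>i=1..p. x i) / real p"
  define U where "U = (\<Sum>i=n - n div 2..n. x i) / real p"
  have p: "p > 0" "p \<le> n" using n by (auto simp: p_def)
  have "L \<le> sorted_median n x"
    using sum_lower_le_median[OF _ mono, folded p_def] n p
    by (simp add: L_def pos_divide_le_eq mult.commute)
  moreover have "sorted_median n x \<le> U"
    using sum_upper_ge_median[OF n mono, folded p_def] p
    by (simp add: U_def pos_le_divide_eq mult.commute)
  moreover have "\<bar>L - mean n x\<bar> \<le> std_dev n x * sqrt ((real n - real p) / real p)"
    unfolding L_def using p by (intro block_average_deviation) auto
  moreover have "\<bar>U - mean n x\<bar> \<le> std_dev n x * sqrt ((real n - real p) / real p)"
    unfolding U_def using n p by (intro block_average_deviation) (auto simp: p_def)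
  ultimately have "\<bar>sorted_median n x - mean n x\<bar>
      \<le> std_dev n x * sqrt ((real n - real p) / real p)"
    by linarith
  then show ?thesis
    using std_dev_nonneg[of n x] p
    by (cases "std_dev n x = 0") (auto simp: pos_divide_le_eq mult.commute)
qed

section \<open>The sharp bounds and the extremal configurations\<close>

theorem theorem1:
  fixes n :: nat and x :: "nat \<Rightarrow> real"
  assumes "n \<ge> 3"
    and "mono_on {1..n} x"
    and "x 1 < x n"
  shows "(\<forall>k. n = 2 * k + 1 \<longrightarrow>
            \<bar>sorted_median n x - mean n x\<bar> / std_dev n x \<le> sqrt (real k / (real k + 1)))
       \<and> (\<forall>k. n = 2 * k \<longrightarrow>
            \<bar>sorted_median n x - mean n x\<bar> / std_dev n x \<le> sqrt ((real k - 1) / (real k + 1)))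
       \<and> (\<forall>k. n = 2 * k
            \<and> (\<forall>i\<in>{1..k + 1}. x i = x 1) \<and> x (k + 1) < x (k + 2) \<and> (\<forall>i\<in>{k + 2..2 * k}. x i = x (k + 2))
            \<longrightarrow> (sorted_median n x - mean n x) / std_dev n x = - sqrt ((real k - 1) / (real k + 1)))
       \<and> (\<forall>k. n = 2 * k
            \<and> (\<forall>i\<in>{1..k - 1}. x i = x 1) \<and> x (k - 1) < x k \<and> (\<forall>i\<in>{k..2 * k}. x i = x k)
            \<longrightarrow> (sorted_median n x - mean n x) / std_dev n x = sqrt ((real k - 1) / (real k + 1)))"
proof (intro conjI allI impI; (elim conjE)?)
  fix k assume "n = 2 * k + 1"
  then show "\<bar>sorted_median n x - mean n x\<bar> / std_dev n x \<le> sqrt (real k / (real k + 1))"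
    using median_mean_bound[of n x] assms by (simp add: add.commute)
next
  fix k assume "n = 2 * k"
  then show "\<bar>sorted_median n x - mean n x\<bar> / std_dev n x \<le> sqrt ((real k - 1) / (real k + 1))"
    using median_mean_bound[of n x] assms by (simp add: add.commute)
next
  fix k
  assume k: "n = 2 * k" and low: "\<forall>i\<in>{1..k + 1}. x i = x 1"
    and jump: "x (k + 1) < x (k + 2)" and high: "\<forall>i\<in>{k + 2..2 * k}. x i = x (k + 2)"
  have k2: "k \<ge> 2" using k assms by simp
  have vals: "x k = x 1" "x (k + 1) = x 1"
    using k2 by (intro bspec[OF low]; simp)+
  have "(x 1 - mean n x) / std_dev n x
      = sgn (x 1 - x (k + 2)) * sqrt ((real n - real (k + 1)) / real (k + 1))"
    using k k2 jump vals
    by (intro two_valued_standard_score[where A = "{1..k + 1}"] bspec[OF low] bspec[OF high]) auto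
  moreover have "sorted_median n x = x 1"
    using k vals by (simp add: sorted_median_def)
  moreover have "sgn (x 1 - x (k + 2)) = -1"
    using jump vals by simp
  ultimately show "(sorted_median n x - mean n x) / std_dev n x
      = - sqrt ((real k - 1) / (real k + 1))"
    using k by (simp add: add.commute)
next
  fix k
  assume k: "n = 2 * k" and low: "\<forall>i\<in>{1..k - 1}. x i = x 1"
    and jump: "x (k - 1) < x k" and high: "\<forall>i\<in>{k..2 * k}. x i = x k"
  have k2: "k \<ge> 2" using k assms by simp
  have vals: "x (k - 1) = x 1" "x (k + 1) = x k"
    using k2 by (intro bspec[OF low] bspec[OF high]; simp)+
  have "(x k - mean n x) / std_dev n x
      = sgn (x k - x 1) * sqrt ((real n - real (k + 1)) / real (k + 1))"
    using k k2 jump vals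
    by (intro two_valued_standard_score[where A = "{k..2 * k}"] bspec[OF low] bspec[OF high]) auto
  moreover have "sorted_median n x = x k"
    using k vals by (simp add: sorted_median_def)
  moreover have "sgn (x k - x 1) = 1"
    using jump vals by simp
  ultimately show "(sorted_median n x - mean n x) / std_dev n x
      = sqrt ((real k - 1) / (real k + 1))"
    using k by (simp add: add.commute)
qed

end
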